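(* Let $(X,\mathcal{H})$ be an $r$-uniform hypergraph with $|X|=n$, and assume that $k \leq r\le n$. Then $\mathcal{H}$ crosses all $k$-partitions of the vertex set $X$ if and only if for every $k$-partition $\mathcal{P}$ of $X$ we have $\mathcal{I}_{n-r}(\mathcal{P}) \not\subseteq \overline{\mathcal{H}^c}$.
   Context: A hypergraph $(X,\mathcal{H})$ is a finite set $X$ with a set $\mathcal{H}$ of subsets of $X$ (edges); it is $r$-uniform if $\mathcal{H}\subseteq\binom{X}{r}$, the family of all $r$-element subsets of $X$. A $k$-partition of $X$ is a partition $\mathcal{P}=(X_1,\dots,X_k)$ of $X$ into precisely $k$ nonempty classes. An $r$-element set $H\subseteq X$ crosses $\mathcal{P}$ if $H$ intersects exactly $\min(r,k)$ of the classes; $\mathcal{H}$ crosses $\mathcal{P}$ if at least one edge does. For a hypergraph $(X,\mathcal{H})$, $\mathcal{H}^c=\{X\setminus H \mid H\in\mathcal{H}\}$ is the hypergraph of complements of the edges. For an $m$-uniform hypergraph $(X,\mathcal{G})$, $\overline{\mathcal{G}}=\binom{X}{m}\setminus\mathcal{G}$. Thus for $r$-uniform $\mathcal{H}$, $\overline{\mathcal{H}^c}=\binom{X}{n-r}\setminus\mathcal{H}^c$. A set $T\subseteq X$ is a transversal of $\mathcal{P}=(X_1,\dots,X_k)$ if $|T\cap X_i|\ge 1$ for every $i$. The complement $S=X\setminus T$ of a transversal is called an independent set for $\mathcal{P}$, i.e. $|S\cap X_i|<|X_i|$ for every $i$. $\mathcal{I}_t(\mathcal{P})$ denotes the set of all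 $t$-element independent sets for $\mathcal{P}$. *)

theory Defs
  imports "HOL-Library.Disjoint_Sets" "HOL-Library.Ramsey"
begin

definition hypergraph :: "'a set \<Rightarrow> 'a set set \<Rightarrow> bool" where
  "hypergraph X \<H> \<longleftrightarrow> finite X \<and> \<H> \<subseteq> Pow X"

definition uniform_hypergraph :: "nat \<Rightarrow> 'a set \<Rightarrow> 'a set set \<Rightarrow> bool" where
  "uniform_hypergraph r X \<H> \<longleftrightarrow> hypergraph X \<H> \<and> \<H> \<subseteq> nsets X r"

text \<open>A partition is an unordered collection of classes; \<^const>\<open>partition_on\<close> already
  requires the classes to be nonempty. Finiteness of \<open>P\<close> is required separately so that
  an infinite \<open>P\<close>, whose \<^const>\<open>card\<close> is \<open>0\<close>, does not count as a \<open>0\<close>-partition.\<close>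

definition k_partition :: "nat \<Rightarrow> 'a set \<Rightarrow> 'a set set \<Rightarrow> bool" where
  "k_partition k X P \<longleftrightarrow> partition_on X P \<and> finite P \<and> card P = k"

text \<open>The numbers \<open>r\<close> and \<open>k\<close> in the phrase ``intersects exactly \<open>min(r,k)\<close> classes''
  are read off as the cardinalities of the edge and of the partition.\<close>

definition set_crosses :: "'a set \<Rightarrow> 'a set set \<Rightarrow> bool" where
  "set_crosses E P \<longleftrightarrow> card {A \<in> P. E \<inter> A \<noteq> {}} = min (card E) (card P)"

definition crosses :: "'a set set \<Rightarrow> 'a set set \<Rightarrow> bool" where
  "crosses \<H> P \<longleftrightarrow> (\<exists>E\<in>\<H>. set_crosses E P)"

definition edge_complements :: "'a set \<Rightarrow> 'a set set \<Rightarrow> 'a set set" where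
  "edge_complements X \<H> = {X - E | E. E \<in> \<H>}"

definition uniform_complement :: "nat \<Rightarrow> 'a set \<Rightarrow> 'a set set \<Rightarrow> 'a set set" where
  "uniform_complement m X \<G> = nsets X m - \<G>"

definition transversal :: "'a set \<Rightarrow> 'a set set \<Rightarrow> 'a set \<Rightarrow> bool" where
  "transversal X P T \<longleftrightarrow> T \<subseteq> X \<and> (\<forall>A\<in>P. card (T \<inter> A) \<ge> 1)"

definition independent_set :: "'a set \<Rightarrow> 'a set set \<Rightarrow> 'a set \<Rightarrow> bool" where
  "independent_set X P S \<longleftrightarrow> (\<exists>T. transversal X P T \<and> S = X - T)"

definition independent_sets :: "nat \<Rightarrow> 'a set \<Rightarrow> 'a set set \<Rightarrow> 'a set set" where
  "independent_sets t X P = {S \<in> nsets X t. independent_set X P S}"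

end

theory Submission
  imports Defs
begin

text \<open>
  The equivalence holds for each \<open>k\<close>-partition \<open>P\<close> separately. Since an edge \<open>E\<close> has
  \<open>r \<ge> k\<close> elements, crossing \<open>P\<close> means meeting all \<open>k\<close> classes, that is, being a
  transversal (\<open>set_crosses_iff_transversal\<close>). Passing to complements in \<open>X\<close>, this says that
  \<open>X - E\<close> is independent (\<open>independent_set_Diff_iff\<close>). As \<open>E\<close> ranges over the edges,
  \<open>X - E\<close> ranges over the complements of edges, all of which have size \<open>n - r\<close>. So some edge
  crosses \<open>P\<close> exactly when some independent \<open>(n - r)\<close>-set is the complement of an edge,
  which is the failure of the inclusion in the theorem.
\<close>

text \<open>The classes met by \<open>E\<close> form a subset of the finite set \<open>P\<close>, so there are \<open>card P\<close> of
  them only if they are all of \<open>P\<close>.\<close>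

lemma set_crosses_iff_transversal:
  assumes "finite X" "E \<subseteq> X" "finite P" "card P \<le> card E"
  shows "set_crosses E P \<longleftrightarrow> transversal X P E"
proof -
  have "finite E"
    using assms(1,2) by (rule rev_finite_subset)
  then have meets: "card (E \<inter> A) \<ge> 1 \<longleftrightarrow> E \<inter> A \<noteq> {}" for A
    by (simp add: Suc_le_eq card_gt_0_iff)
  have "set_crosses E P \<longleftrightarrow> card {A \<in> P. E \<inter> A \<noteq> {}} = card P"
    using assms(4) by (simp add: set_crosses_def)
  also have "\<dots> \<longleftrightarrow> {A \<in> P. E \<inter> A \<noteq> {}} = P"
    by (rule iffI, rule card_subset_eq[OF assms(3)]) simp_all
  also have "\<dots> \<longleftrightarrow> transversal X P E"
    using assms(2) unfolding transversal_def meets by blast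
  finally show ?thesis .
qed

text \<open>A subset of \<open>X\<close> is determined by its complement, so the transversal that witnesses the
  independence of \<open>X - E\<close> can only be \<open>E\<close>.\<close>

lemma independent_set_Diff_iff:
  assumes "E \<subseteq> X"
  shows "independent_set X P (X - E) \<longleftrightarrow> transversal X P E"
proof -
  have "T = E" if "transversal X P T" "X - E = X - T" for T
    using that assms unfolding transversal_def by blast
  then show ?thesis
    unfolding independent_set_def by blast
qed

lemma crosses_iff_not_independent_sets_subset:
  assumes H: "uniform_hypergraph r X \<H>" and "finite P" "card P \<le> r"
  shows "crosses \<H> P \<longleftrightarrow>
    \<not> independent_sets (card X - r) X P
        \<subseteq> uniform_complement (card X - r) X (edge_complements X \<H>)"
proof -
  have fin: "finite X"
    using H by (simp add: uniform_hypergraph_def hypergraph_def)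
  have edge: "E \<subseteq> X" "card E = r" if "E \<in> \<H>" for E
    using H that by (auto simp: uniform_hypergraph_def nsets_def)
  have size: "X - E \<in> nsets X (card X - r)" if "E \<in> \<H>" for E
    using edge[OF that] fin by (simp add: nsets_def card_Diff_subset finite_subset)
  have "crosses \<H> P \<longleftrightarrow> (\<exists>E\<in>\<H>. independent_set X P (X - E))"
    unfolding crosses_def
    using assms(2,3) fin edge
    by (simp add: set_crosses_iff_transversal independent_set_Diff_iff cong: bex_cong)
  also have "\<dots> \<longleftrightarrow> (\<exists>S \<in> edge_complements X \<H>. S \<in> independent_sets (card X - r) X P)"
    using size unfolding edge_complements_def independent_sets_def by blast
  also have "\<dots> \<longleftrightarrow> \<not> independent_sets (card X - r) X P
      \<subseteq> uniform_complement (card X - r) X (edge_complements X \<H>)"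
    unfolding uniform_complement_def independent_sets_def by blast
  finally show ?thesis .
qed

theorem proposition18:
  fixes X :: "'a set" and \<H> :: "'a set set" and k r n :: nat
  assumes "uniform_hypergraph r X \<H>"
    and "card X = n"
    and "k \<le> r" and "r \<le> n"
  shows "(\<forall>P. k_partition k X P \<longrightarrow> crosses \<H> P) \<longleftrightarrow>
    (\<forall>P. k_partition k X P \<longrightarrow>
      \<not> independent_sets (n - r) X P \<subseteq> uniform_complement (n - r) X (edge_complements X \<H>))"
proof (intro iff_allI imp_cong refl)
  fix P assume "k_partition k X P"
  then have "finite P" "card P \<le> r"
    using assms(3) by (auto simp: k_partition_def)
  then show "crosses \<H> P \<longleftrightarrow>
      \<not> independent_sets (n - r) X P \<subseteq> uniform_complement (n - r) X (edge_complements X \<H>)"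
    using crosses_iff_not_independent_sets_subset[OF assms(1)] assms(2) by simp
qed

end
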